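(* The following inequalities hold. (i) For $x>0$, $$C\big(I_\nu(x)\big)<C\big(\tilde{t}_{\mu,\nu}(x)\big)<C\big(I_\nu(x)\big)+2b_{\mu,\nu}(x),$$ where the lower bound is valid for $\mu>-1$, $0\leq\nu<\mu+1$ and the upper bound is valid for $\mu>-2$, $-1\leq\nu<\mu+1$. (ii) For $x>0$, $$\sqrt{\big(\nu-\tfrac{1}{2}\big)^2+x^2}-\tfrac{1}{2}<C\big(\tilde{t}_{\mu,\nu}(x)\big)<\sqrt{\big(\nu+\tfrac{1}{2}\big)^2+x^2}+2b_{\mu,\nu}(x)-\tfrac{1}{2},$$ and $$x\coth(x)-\nu<C\big(\tilde{t}_{\mu,\nu}(x)\big)<x\tanh(x)+\nu+2b_{\mu,\nu}(x),$$ where both lower bounds hold for $\mu>-\frac{1}{2}$, $\frac{1}{2}\leq\nu<\mu+1$, and both upper bounds hold for $\mu>-\frac{3}{2}$, $-\frac{1}{2}\leq\nu<\mu+1$.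
   Context: For real $\mu,\nu$ and $x>0$, the (normalized) modified Lommel function of the first kind is $$\tilde{t}_{\mu,\nu}(x)=\sum_{k=0}^\infty\frac{(\frac{1}{2}x)^{\mu+2k+1}}{\Gamma\big(k+\frac{\mu-\nu+3}{2}\big)\Gamma\big(k+\frac{\mu+\nu+3}{2}\big)},$$ and the modified Bessel function of the first kind is $$I_\nu(x)=\sum_{k=0}^\infty\frac{(\frac{1}{2}x)^{2k+\nu}}{k!\,\Gamma(k+\nu+1)},$$ where $1/\Gamma(z)$ is interpreted as $0$ for $z=0,-1,-2,\ldots$. The condition numbers are $C\big(\tilde{t}_{\mu,\nu}(x)\big)=x\,\tilde{t}_{\mu,\nu}'(x)/\tilde{t}_{\mu,\nu}(x)$ and $C\big(I_\nu(x)\big)=x\,I_\nu'(x)/I_\nu(x)$, with primes denoting differentiation in $x$. For $\mu>-2$ and $|\nu+1|<\mu+2$, $$b_{\mu,\nu}(x)=\frac{(\frac{1}{2}x)^{\mu+1}}{\Gamma\big(\frac{\mu-\nu+1}{2}\big)\Gamma\big(\frac{\mu+\nu+3}{2}\big)\,\tilde{t}_{\mu,\nu}(x)}.$$ *)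

theory Defs
  imports "HOL-Analysis.Analysis"
begin

text \<open>
  The library's \<open>rGamma\<close> is the entire function \<open>1/\<Gamma>\<close>, with value \<open>0\<close> at \<open>0, -1, -2, \<dots>\<close>.
  Both series below converge for every \<open>x > 0\<close> and all real parameters; the functions are only
  meaningful for \<open>x > 0\<close>, where \<open>powr\<close> is the usual real power.
\<close>

definition mod_lommel :: "real \<Rightarrow> real \<Rightarrow> real \<Rightarrow> real" where
  "mod_lommel \<mu> \<nu> x =
     (\<Sum>k. (x / 2) powr (\<mu> + 2 * real k + 1)
            * rGamma (real k + (\<mu> - \<nu> + 3) / 2) * rGamma (real k + (\<mu> + \<nu> + 3) / 2))"

definition bessel_I :: "real \<Rightarrow> real \<Rightarrow> real" where
  "bessel_I \<nu> x = (\<Sum>k. (x / 2) powr (2 * real k + \<nu>) / fact k * rGamma (real k + \<nu> + 1))"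

definition condition_number :: "(real \<Rightarrow> real) \<Rightarrow> real \<Rightarrow> real" where
  "condition_number f x = x * deriv f x / f x"

text \<open>
  Used only for \<open>\<mu> > -2\<close> and \<open>\<bar>\<nu> + 1\<bar> < \<mu> + 2\<close>, where both Gamma arguments are positive.
\<close>

definition lommel_b :: "real \<Rightarrow> real \<Rightarrow> real \<Rightarrow> real" where
  "lommel_b \<mu> \<nu> x =
     (x / 2) powr (\<mu> + 1)
       / (Gamma ((\<mu> - \<nu> + 1) / 2) * Gamma ((\<mu> + \<nu> + 3) / 2) * mod_lommel \<mu> \<nu> x)"

definition coth :: "real \<Rightarrow> real" where
  "coth x = cosh x / sinh x"

end

theory Submission
  imports Defs
begin

text \<open>
  With \<open>\<rho> = (\<mu> - \<nu> + 1) / 2\<close> and \<open>y = x\<^sup>2 / 4\<close>, both functions are powers of \<open>x / 2\<close> times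
  the entire series \<open>lommel_series \<rho> \<nu> y\<close>, where \<open>\<rho> = 0\<close> gives the Bessel function. The pair
  \<open>P = lommel_series \<rho> \<nu>\<close>, \<open>Q = lommel_series \<rho> (\<nu> + 1)\<close> satisfies a first-order linear system.
  After clearing denominators, each inequality asserts that an expression \<open>F\<close> in such pairs is
  positive, and the system yields \<open>y * F' + e * F > 0\<close> with \<open>e > 0\<close>, so that \<open>y powr e * F\<close>
  increases from its value \<open>0\<close> at the origin (for the \<open>tanh\<close> bound, and for the square root
  bound at \<open>\<nu> = -1/2\<close>, it is \<open>F\<close> itself that is nondecreasing). The estimates in (ii) follow from (i) and
  the bounds \<open>I\<^bsub>\<nu>+1\<^esub> / I\<^bsub>\<nu>\<^esub> \<le> x / (\<nu> + 1/2 + sqrt ((\<nu> + 1/2)\<^sup>2 + x\<^sup>2))\<close> and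
  \<open>I\<^bsub>\<nu>+1\<^esub> / I\<^bsub>\<nu>\<^esub> \<le> tanh x\<close>, valid for \<open>\<nu> \<ge> -1/2\<close>.
\<close>

section \<open>Positivity from differential inequalities\<close>

text \<open>For \<open>z > 0\<close> the derivative of \<open>z powr e * F z\<close> is
  \<open>z powr (e - 1) * (z * F' z + e * F z)\<close>, so the weighted function strictly increases;
  \<open>e > 0\<close> makes it vanish at 0 whatever \<open>F 0\<close> is.\<close>

lemma powr_weighted_pos:
  fixes F F' :: "real \<Rightarrow> real"
  assumes "e > 0" "y > 0"
    and der: "\<And>z. (F has_real_derivative F' z) (at z)"
    and pos: "\<And>z. z > 0 \<Longrightarrow> z * F' z + e * F z > 0"
  shows "F y > 0"
proof -
  let ?G = "\<lambda>z. z powr e * F z"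
  have "?G 0 < ?G y"
  \<comment> \<open>For \<open>e < 1\<close> the weight is not differentiable at 0, hence the test
    with interior derivatives and continuity up to the endpoint.\<close>
  proof (rule DERIV_pos_imp_increasing_open[OF \<open>y > 0\<close>])
    fix z :: real assume "0 < z" "z < y"
    have "(?G has_real_derivative e * z powr (e - 1) * F z + z powr e * F' z) (at z)"
      using \<open>0 < z\<close> by (auto intro!: derivative_eq_intros der)
    moreover have "e * z powr (e - 1) * F z + z powr e * F' z
                     = z powr (e - 1) * (z * F' z + e * F z)"
      using \<open>0 < z\<close> by (simp add: powr_diff field_simps)
    moreover have "z powr (e - 1) * (z * F' z + e * F z) > 0"
      using pos[OF \<open>0 < z\<close>] \<open>0 < z\<close> by simp
    ultimately show "\<exists>d. (?G has_real_derivative d) (at z) \<and> d > 0"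
      by metis
  next
    have "continuous_on {0..y} F"
      using der by (meson DERIV_continuous continuous_at_imp_continuous_on)
    moreover have "continuous_on {0..y} (\<lambda>z. z powr e)"
      using \<open>e > 0\<close> by (intro continuous_on_powr') (auto intro: continuous_intros)
    ultimately show "continuous_on {0..y} ?G"
      by (intro continuous_on_mult)
  qed
  then show ?thesis
    using \<open>y > 0\<close> by (simp add: zero_less_mult_iff)
qed

text \<open>The analogue for exponent 0: no weight forces the value 0 at the origin, so the sign of
  \<open>F 0\<close> enters as a hypothesis.\<close>

lemma nonneg_of_deriv_nonneg:
  fixes F F' :: "real \<Rightarrow> real"
  assumes "y > 0" "F 0 \<ge> 0"
    and der: "\<And>z. (F has_real_derivative F' z) (at z)"
    and nonneg: "\<And>z. z > 0 \<Longrightarrow> F' z \<ge> 0"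
  shows "F y \<ge> 0"
proof -
  have "F 0 \<le> F y"
  proof (rule DERIV_nonneg_imp_increasing_open[of 0 y])
    show "continuous_on {0..y} F"
      using der by (meson DERIV_continuous continuous_at_imp_continuous_on)
    show "\<exists>d. (F has_real_derivative d) (at z) \<and> d \<ge> 0" if "0 < z" for z
      using der nonneg[OF that] by blast
  qed (use \<open>y > 0\<close> in simp)
  with \<open>F 0 \<ge> 0\<close> show ?thesis by simp
qed

section \<open>The entire series and its first-order system\<close>

text \<open>For \<open>\<rho> = (\<mu> - \<nu> + 1) / 2\<close> these are the Gamma factors of
  \<open>mod_lommel\<close>; for \<open>\<rho> = 0\<close> the first is 1/k!. With
  \<open>rGamma\<close> the recurrences hold at the poles of Gamma too.\<close>

definition lommel_coeff :: "real \<Rightarrow> real \<Rightarrow> nat \<Rightarrow> real" where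
  "lommel_coeff \<rho> \<nu> k = rGamma (real k + \<rho> + 1) * rGamma (real k + \<rho> + \<nu> + 1)"

text \<open>Away from the poles this is, up to a constant factor, the hypergeometric function 1F2(1;
  \<rho> + 1, \<rho> + \<nu> + 1; y).\<close>

definition lommel_series :: "real \<Rightarrow> real \<Rightarrow> real \<Rightarrow> real" where
  "lommel_series \<rho> \<nu> y = (\<Sum>k. lommel_coeff \<rho> \<nu> k * y ^ k)"

definition lommel_series_deriv :: "real \<Rightarrow> real \<Rightarrow> real \<Rightarrow> real" where
  "lommel_series_deriv \<rho> \<nu> y = (\<Sum>k. diffs (lommel_coeff \<rho> \<nu>) k * y ^ k)"

lemma lommel_coeff_Suc:
  "(real k + \<rho> + 1) * (real k + \<rho> + \<nu> + 1) * lommel_coeff \<rho> \<nu> (Suc k) = lommel_coeff \<rho> \<nu> k"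
proof -
  have "lommel_coeff \<rho> \<nu> (Suc k)
      = rGamma ((real k + \<rho> + 1) + 1) * rGamma ((real k + \<rho> + \<nu> + 1) + 1)"
    by (simp add: lommel_coeff_def add_ac)
  moreover have "lommel_coeff \<rho> \<nu> k = ((real k + \<rho> + 1) * rGamma ((real k + \<rho> + 1) + 1))
      * ((real k + \<rho> + \<nu> + 1) * rGamma ((real k + \<rho> + \<nu> + 1) + 1))"
    by (simp only: lommel_coeff_def rGamma_plus1)
  ultimately show ?thesis
    by (simp only: mult_ac)
qed

lemma summable_lommel: "summable (\<lambda>k. lommel_coeff \<rho> \<nu> k * y ^ k)"
proof -
  \<comment> \<open>From \<open>N\<close> on, one factor of the recurrence is at least
    \<open>2 * \<bar>y\<bar>\<close> and the other at least 1, so successive terms shrink by at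
    least 1/2.\<close>
  obtain N :: nat where N: "real N \<ge> \<bar>\<rho>\<bar> + \<bar>\<nu>\<bar> + 2 * \<bar>y\<bar> + 1"
    using real_arch_simple by blast
  show ?thesis
  proof (rule summable_ratio_test[of "1/2" N])
    fix n assume "n \<ge> N"
    with N have n: "real n \<ge> \<bar>\<rho>\<bar> + \<bar>\<nu>\<bar> + 2 * \<bar>y\<bar> + 1" by linarith
    let ?m = "(real n + \<rho> + 1) * (real n + \<rho> + \<nu> + 1)"
    have "(2 * \<bar>y\<bar>) * 1 \<le> ?m"
      using n by (intro mult_mono) (auto simp: abs_if split: if_splits)
    then have "2 * \<bar>y\<bar> * \<bar>lommel_coeff \<rho> \<nu> (Suc n)\<bar> \<le> \<bar>?m\<bar> * \<bar>lommel_coeff \<rho> \<nu> (Suc n)\<bar>"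
      by (intro mult_right_mono) auto
    also have "\<dots> = \<bar>lommel_coeff \<rho> \<nu> n\<bar>"
      by (metis abs_mult lommel_coeff_Suc)
    finally have "2 * \<bar>y\<bar> * \<bar>lommel_coeff \<rho> \<nu> (Suc n)\<bar> * \<bar>y\<bar> ^ n \<le> \<bar>lommel_coeff \<rho> \<nu> n\<bar> * \<bar>y\<bar> ^ n"
      by (intro mult_right_mono) auto
    then show "norm (lommel_coeff \<rho> \<nu> (Suc n) * y ^ Suc n)
                 \<le> 1/2 * norm (lommel_coeff \<rho> \<nu> n * y ^ n)"
      by (simp add: abs_mult power_abs algebra_simps)
  qed simp
qed

lemma lommel_series_has_derivative:
  "(lommel_series \<rho> \<nu> has_real_derivative lommel_series_deriv \<rho> \<nu> y) (at y)"
  using termdiffs_strong_converges_everywhere[OF summable_lommel]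
  unfolding lommel_series_def[abs_def] lommel_series_deriv_def by blast

lemma lommel_series_deriv_sums:
  "(\<lambda>k. real k * lommel_coeff \<rho> \<nu> k * y ^ k) sums (y * lommel_series_deriv \<rho> \<nu> y)"
proof -
  have "summable (\<lambda>k. diffs (lommel_coeff \<rho> \<nu>) k * y ^ k)"
    by (rule termdiff_converges_all) (rule summable_lommel)
  from sums_mult[OF diffs_equiv[OF this], of y]
  have "(\<lambda>k. y * (real k * lommel_coeff \<rho> \<nu> k * y ^ (k - Suc 0)))
          sums (y * lommel_series_deriv \<rho> \<nu> y)"
    unfolding lommel_series_deriv_def .
  \<comment> \<open>At \<open>k = 0\<close> the exponent \<open>k - Suc 0\<close> truncates to 0,
    but the factor \<open>real k\<close> kills the term.\<close>
  moreover have "y * (real k * lommel_coeff \<rho> \<nu> k * y ^ (k - Suc 0))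
                   = real k * lommel_coeff \<rho> \<nu> k * y ^ k" for k
    by (cases k) auto
  ultimately show ?thesis by simp
qed

lemma lommel_series_sums: "(\<lambda>k. lommel_coeff \<rho> \<nu> k * y ^ k) sums lommel_series \<rho> \<nu> y"
  unfolding lommel_series_def using summable_lommel by (rule summable_sums)

text \<open>The factor \<open>k + \<rho>\<close> lowers the first Gamma argument by one; reindexing
  by one then gives the series for \<open>\<nu> + 1\<close>. The term \<open>k = 0\<close> is left
  over as the constant, which vanishes for \<open>\<rho> = 0\<close> because
  \<open>rGamma 0 = 0\<close>.\<close>

lemma lommel_series_raise:
  "y * lommel_series_deriv \<rho> \<nu> y + \<rho> * lommel_series \<rho> \<nu> y
     = rGamma \<rho> * rGamma (\<rho> + \<nu> + 1) + y * lommel_series \<rho> (\<nu> + 1) y"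
proof -
  let ?f = "\<lambda>k. (real k + \<rho>) * lommel_coeff \<rho> \<nu> k * y ^ k"
  have f: "?f sums (y * lommel_series_deriv \<rho> \<nu> y + \<rho> * lommel_series \<rho> \<nu> y)"
    using sums_add[OF lommel_series_deriv_sums sums_mult[OF lommel_series_sums[of \<rho> \<nu> y]], of \<rho> \<nu> y \<rho>]
    by (simp add: algebra_simps)
  have f0: "?f 0 = rGamma \<rho> * rGamma (\<rho> + \<nu> + 1)"
    using rGamma_plus1[of \<rho>] by (simp add: lommel_coeff_def)
  have step: "?f (Suc k) = y * (lommel_coeff \<rho> (\<nu> + 1) k * y ^ k)" for k
    using rGamma_plus1[of "real k + \<rho> + 1"]
    by (simp add: lommel_coeff_def add_ac mult_ac)
  have "(\<lambda>k. ?f (Suc k)) sums (y * lommel_series \<rho> (\<nu> + 1) y)"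
    unfolding step by (intro sums_mult lommel_series_sums)
  then have "?f sums (y * lommel_series \<rho> (\<nu> + 1) y + ?f 0)"
    by (subst (asm) sums_Suc_iff) simp
  with f have "y * lommel_series_deriv \<rho> \<nu> y + \<rho> * lommel_series \<rho> \<nu> y
      = y * lommel_series \<rho> (\<nu> + 1) y + ?f 0"
    by (rule sums_unique2)
  then show ?thesis using f0 by simp
qed

text \<open>Here the factor \<open>k + \<rho> + \<nu> + 1\<close> lowers the second Gamma argument.
  The coefficients match without reindexing, so no constant appears.\<close>

lemma lommel_series_lower:
  "y * lommel_series_deriv \<rho> (\<nu> + 1) y + (\<rho> + \<nu> + 1) * lommel_series \<rho> (\<nu> + 1) y
     = lommel_series \<rho> \<nu> y"
proof -
  have "(\<lambda>k. (real k + (\<rho> + \<nu> + 1)) * lommel_coeff \<rho> (\<nu> + 1) k * y ^ k)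
     sums (y * lommel_series_deriv \<rho> (\<nu> + 1) y + (\<rho> + \<nu> + 1) * lommel_series \<rho> (\<nu> + 1) y)"
    using sums_add[OF lommel_series_deriv_sums sums_mult[OF lommel_series_sums[of \<rho> "\<nu> + 1" y]],
        of \<rho> "\<nu> + 1" y "\<rho> + \<nu> + 1"]
    by (simp add: algebra_simps)
  moreover have "(real k + (\<rho> + \<nu> + 1)) * lommel_coeff \<rho> (\<nu> + 1) k = lommel_coeff \<rho> \<nu> k" for k
    using rGamma_plus1[of "real k + \<rho> + \<nu> + 1"]
    by (simp add: lommel_coeff_def add_ac mult_ac)
  ultimately have "(\<lambda>k. lommel_coeff \<rho> \<nu> k * y ^ k)
     sums (y * lommel_series_deriv \<rho> (\<nu> + 1) y + (\<rho> + \<nu> + 1) * lommel_series \<rho> (\<nu> + 1) y)"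
    by (simp only:)
  then show ?thesis
    using lommel_series_sums by (rule sums_unique2)
qed

lemma rGamma_real_pos: "z > 0 \<Longrightarrow> rGamma z > (0::real)"
  by (simp add: rGamma_inverse_Gamma Gamma_real_pos)

lemma rGamma_real_nonneg: "z \<ge> 0 \<Longrightarrow> rGamma z \<ge> (0::real)"
  using rGamma_real_pos[of z] by (cases "z = 0") auto

text \<open>For \<open>\<rho> = 0\<close>, \<open>\<nu> = -1\<close> the constant coefficient vanishes; positivity comes from the linear one.\<close>
lemma lommel_series_pos:
  assumes "\<rho> \<ge> 0" "\<rho> + \<nu> + 1 \<ge> 0" "y > 0"
  shows "lommel_series \<rho> \<nu> y > 0"
  unfolding lommel_series_def
proof (rule suminf_pos2[OF summable_lommel])
  show "0 \<le> lommel_coeff \<rho> \<nu> k * y ^ k" for k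
    using assms by (auto simp: lommel_coeff_def intro!: mult_nonneg_nonneg rGamma_real_nonneg)
  show "0 < lommel_coeff \<rho> \<nu> 1 * y ^ 1"
    using assms by (auto simp: lommel_coeff_def intro!: mult_pos_pos rGamma_real_pos)
qed

section \<open>Comparison of the Lommel and Bessel series\<close>

text \<open>The numerator of Q/P for \<open>\<rho> = 0\<close> minus Q/P for \<open>\<rho>\<close>,
  where P and Q are the series at \<open>\<nu>\<close> and \<open>\<nu> + 1\<close>.\<close>

definition bessel_cross :: "real \<Rightarrow> real \<Rightarrow> real \<Rightarrow> real" where
  "bessel_cross \<rho> \<nu> y = lommel_series 0 (\<nu> + 1) y * lommel_series \<rho> \<nu> y
                        - lommel_series \<rho> (\<nu> + 1) y * lommel_series 0 \<nu> y"

definition bessel_cross_deriv :: "real \<Rightarrow> real \<Rightarrow> real \<Rightarrow> real" where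
  "bessel_cross_deriv \<rho> \<nu> y
     = lommel_series_deriv 0 (\<nu> + 1) y * lommel_series \<rho> \<nu> y
       + lommel_series 0 (\<nu> + 1) y * lommel_series_deriv \<rho> \<nu> y
       - (lommel_series_deriv \<rho> (\<nu> + 1) y * lommel_series 0 \<nu> y
         + lommel_series \<rho> (\<nu> + 1) y * lommel_series_deriv 0 \<nu> y)"

lemma bessel_cross_has_derivative:
  "(bessel_cross \<rho> \<nu> has_real_derivative bessel_cross_deriv \<rho> \<nu> y) (at y)"
  unfolding bessel_cross_def[abs_def] bessel_cross_deriv_def
  by (auto intro!: derivative_eq_intros lommel_series_has_derivative)

text \<open>After substituting the system, the terms \<open>?P * ?A\<close> and
  \<open>y * ?Q * ?B\<close> cancel. The rest is a multiple of the cross product plus the constant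
  of \<open>lommel_series_raise\<close> times \<open>?B\<close>.\<close>

lemma bessel_cross_ode:
  "y * bessel_cross_deriv \<rho> \<nu> y + (\<rho> + \<nu> + 1) * bessel_cross \<rho> \<nu> y
     = rGamma \<rho> * rGamma (\<rho> + \<nu> + 1) * lommel_series 0 (\<nu> + 1) y"
proof -
  let ?c = "rGamma \<rho> * rGamma (\<rho> + \<nu> + 1)"
  let ?P = "lommel_series \<rho> \<nu> y" and ?Q = "lommel_series \<rho> (\<nu> + 1) y"
  let ?A = "lommel_series 0 \<nu> y" and ?B = "lommel_series 0 (\<nu> + 1) y"
  have "y * lommel_series_deriv \<rho> \<nu> y = ?c + y * ?Q - \<rho> * ?P"
    "y * lommel_series_deriv \<rho> (\<nu> + 1) y = ?P - (\<rho> + \<nu> + 1) * ?Q"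
    "y * lommel_series_deriv 0 \<nu> y = y * ?B"
    "y * lommel_series_deriv 0 (\<nu> + 1) y = ?A - (\<nu> + 1) * ?B"
    using lommel_series_raise[of y \<rho> \<nu>] lommel_series_raise[of y 0 \<nu>]
      lommel_series_lower[of y \<rho> \<nu>] lommel_series_lower[of y 0 \<nu>]
    by simp_all
  moreover have "y * bessel_cross_deriv \<rho> \<nu> y
      = (y * lommel_series_deriv 0 (\<nu> + 1) y) * ?P + ?B * (y * lommel_series_deriv \<rho> \<nu> y)
        - ((y * lommel_series_deriv \<rho> (\<nu> + 1) y) * ?A + ?Q * (y * lommel_series_deriv 0 \<nu> y))"
    by (simp add: bessel_cross_deriv_def algebra_simps)
  ultimately have "y * bessel_cross_deriv \<rho> \<nu> y
      = (?A - (\<nu> + 1) * ?B) * ?P + ?B * (?c + y * ?Q - \<rho> * ?P)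
        - ((?P - (\<rho> + \<nu> + 1) * ?Q) * ?A + ?Q * (y * ?B))"
    by (simp only:)
  then show ?thesis
    by (simp add: bessel_cross_def algebra_simps)
qed

lemma bessel_cross_pos:
  assumes "\<rho> > 0" "\<nu> \<ge> -1" "y > 0"
  shows "bessel_cross \<rho> \<nu> y > 0"
proof (rule powr_weighted_pos[where e = "\<rho> + \<nu> + 1"
    and F = "bessel_cross \<rho> \<nu>" and F' = "bessel_cross_deriv \<rho> \<nu>"])
  show "(bessel_cross \<rho> \<nu> has_real_derivative bessel_cross_deriv \<rho> \<nu> z) (at z)" for z
    by (rule bessel_cross_has_derivative)
  show "z * bessel_cross_deriv \<rho> \<nu> z + (\<rho> + \<nu> + 1) * bessel_cross \<rho> \<nu> z > 0" if "z > 0" for z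
    unfolding bessel_cross_ode
    using assms that by (auto intro!: mult_pos_pos rGamma_real_pos lommel_series_pos)
qed (use assms in auto)

text \<open>The lower bound in (i) with denominators cleared.\<close>

lemma bessel_cross_less:
  assumes "\<rho> > 0" "\<nu> \<ge> 0" "y > 0"
  shows "y * bessel_cross \<rho> \<nu> y < rGamma \<rho> * rGamma (\<rho> + \<nu> + 1) * lommel_series 0 \<nu> y"
proof -
  let ?c = "rGamma \<rho> * rGamma (\<rho> + \<nu> + 1)"
  let ?F = "\<lambda>z. ?c * lommel_series 0 \<nu> z - z * bessel_cross \<rho> \<nu> z"
  let ?F' = "\<lambda>z. ?c * lommel_series_deriv 0 \<nu> z
                   - (bessel_cross \<rho> \<nu> z + z * bessel_cross_deriv \<rho> \<nu> z)"
  have "?F y > 0"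
  \<comment> \<open>The exponent \<open>\<rho> + \<nu>\<close> is the one that cancels all
    cross-product terms, as the extra factor \<open>z\<close> lowers the exponent of
    \<open>bessel_cross_ode\<close> by one. The forcing term cancels against the derivative of
    \<open>lommel_series 0 \<nu>\<close>.\<close>
  proof (rule powr_weighted_pos[where e = "\<rho> + \<nu>" and F = ?F and F' = ?F'])
    show "(?F has_real_derivative ?F' z) (at z)" for z
      by (auto intro!: derivative_eq_intros lommel_series_has_derivative bessel_cross_has_derivative)
    fix z :: real assume "z > 0"
    have P0: "z * lommel_series_deriv 0 \<nu> z = z * lommel_series 0 (\<nu> + 1) z"
      using lommel_series_raise[of z 0 \<nu>] by simp
    have V: "z * bessel_cross_deriv \<rho> \<nu> z
        = ?c * lommel_series 0 (\<nu> + 1) z - (\<rho> + \<nu> + 1) * bessel_cross \<rho> \<nu> z"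
      using bessel_cross_ode[of z \<rho> \<nu>] by simp
    have "z * ?F' z + (\<rho> + \<nu>) * ?F z = ?c * (z * lommel_series_deriv 0 \<nu> z)
        - z * (bessel_cross \<rho> \<nu> z + z * bessel_cross_deriv \<rho> \<nu> z) + (\<rho> + \<nu>) * ?F z"
      by (simp add: algebra_simps)
    also have "\<dots> = (\<rho> + \<nu>) * ?c * lommel_series 0 \<nu> z"
      unfolding P0 V by (simp add: algebra_simps)
    also have "\<dots> > 0"
      using assms \<open>z > 0\<close> by (auto intro!: mult_pos_pos rGamma_real_pos lommel_series_pos)
    finally show "z * ?F' z + (\<rho> + \<nu>) * ?F z > 0" .
  qed (use assms in auto)
  then show ?thesis by simp
qed

section \<open>Bounds for ratios of consecutive Bessel functions\<close>

text \<open>Divided by the square of P, this is a quadratic inequality for Q/P; solving it yields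
  the square root bound.\<close>

lemma bessel_amos:
  assumes "\<nu> \<ge> -1/2" "y > 0"
  shows "y * (lommel_series 0 (\<nu> + 1) y)\<^sup>2
           + (\<nu> + 1/2) * lommel_series 0 \<nu> y * lommel_series 0 (\<nu> + 1) y
         \<le> (lommel_series 0 \<nu> y)\<^sup>2"
proof -
  let ?P = "lommel_series 0 \<nu>" and ?Q = "lommel_series 0 (\<nu> + 1)"
  let ?P' = "lommel_series_deriv 0 \<nu>" and ?Q' = "lommel_series_deriv 0 (\<nu> + 1)"
  let ?a = "\<nu> + 1/2"
  let ?F = "\<lambda>z. ?P z * ?P z - ?a * (?P z * ?Q z) - z * (?Q z * ?Q z)"
  let ?F' = "\<lambda>z. 2 * ?P z * ?P' z - ?a * (?P' z * ?Q z + ?P z * ?Q' z)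
                   - (?Q z * ?Q z + 2 * z * ?Q z * ?Q' z)"
  have der: "(?F has_real_derivative ?F' z) (at z)" for z
    by (auto intro!: derivative_eq_intros lommel_series_has_derivative simp: algebra_simps)
  \<comment> \<open>The choice \<open>?a = \<nu> + 1/2\<close> makes the terms in
    \<open>z * ?Q z * ?Q z\<close> cancel.\<close>
  have ode: "z * ?F' z + ?a * ?F z = ?a * (?P z * ?Q z) / 2" for z
  proof -
    have "z * ?P' z = z * ?Q z" "z * ?Q' z = ?P z - (\<nu> + 1) * ?Q z"
      using lommel_series_raise[of z 0 \<nu>] lommel_series_lower[of z 0 \<nu>] by auto
    then have "2 * (z * ?F' z + ?a * ?F z) = ?a * (?P z * ?Q z)"
      by (simp add: field_simps) algebra
    then show ?thesis by simp
  qed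
  have PQ: "?P z * ?Q z > 0" if "z > 0" for z
    using assms that by (auto intro!: mult_pos_pos lommel_series_pos)
  have "?F y \<ge> 0"
  proof (cases "?a = 0")
    \<comment> \<open>At \<open>\<nu> = -1/2\<close> the exponent degenerates and \<open>?F'\<close>
      vanishes for \<open>z > 0\<close>: this is cosh^2 - sinh^2 = 1 up to a constant
      factor.\<close>
    case True
    show ?thesis
    proof (rule nonneg_of_deriv_nonneg[where F = ?F and F' = ?F'])
      show "?F' z \<ge> 0" if "z > 0" for z
        using ode[of z] that True by simp
    qed (use der True assms in auto)
  next
    case False
    with assms have "?a > 0" by simp
    then have "z * ?F' z + ?a * ?F z > 0" if "z > 0" for z
      unfolding ode using \<open>?a > 0\<close> PQ[OF that] by simp
    from powr_weighted_pos[OF \<open>?a > 0\<close> \<open>y > 0\<close> der this] show ?thesis by simp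
  qed
  then show ?thesis by (simp add: power2_eq_square algebra_simps)
qed

text \<open>The bound \<open>tanh x\<close> for the Bessel ratio, cleared of denominators; it is an
  equality at \<open>\<nu> = -1/2\<close>. Differentiation is in \<open>x\<close> itself, to suit
  the hyperbolic functions.\<close>

lemma bessel_tanh:
  assumes "\<nu> \<ge> -1/2" "x > 0"
  shows "x / 2 * lommel_series 0 (\<nu> + 1) (x\<^sup>2 / 4) * cosh x \<le> sinh x * lommel_series 0 \<nu> (x\<^sup>2 / 4)"
proof -
  let ?P = "\<lambda>z::real. lommel_series 0 \<nu> (z\<^sup>2 / 4)"
  let ?Q = "\<lambda>z::real. lommel_series 0 (\<nu> + 1) (z\<^sup>2 / 4)"
  let ?P' = "\<lambda>z::real. lommel_series_deriv 0 \<nu> (z\<^sup>2 / 4)"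
  let ?Q' = "\<lambda>z::real. lommel_series_deriv 0 (\<nu> + 1) (z\<^sup>2 / 4)"
  let ?F = "\<lambda>z. sinh z * ?P z - z / 2 * ?Q z * cosh z"
  let ?F' = "\<lambda>z. cosh z * ?P z + ?P' z * (z / 2) * sinh z
     - ((1 / 2 * ?Q z + ?Q' z * (z / 2) * (z / 2)) * cosh z + sinh z * (z / 2 * ?Q z))"
  have sq: "((\<lambda>z::real. z\<^sup>2 / 4) has_real_derivative z / 2) (at z)" for z
    by (auto intro!: derivative_eq_intros)
  have dP: "(?P has_real_derivative ?P' z * (z / 2)) (at z)" for z
    by (rule DERIV_chain2[OF lommel_series_has_derivative sq])
  have dQ: "(?Q has_real_derivative ?Q' z * (z / 2)) (at z)" for z
    by (rule DERIV_chain2[OF lommel_series_has_derivative sq])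
  have "?F x \<ge> 0"
  proof (rule nonneg_of_deriv_nonneg[where F = ?F and F' = ?F'])
    show "(?F has_real_derivative ?F' z) (at z)" for z
    proof -
      have half: "((\<lambda>z::real. z / 2) has_real_derivative 1 / 2) (at z)"
        by (auto intro!: derivative_eq_intros)
      have "((\<lambda>z. z / 2 * ?Q z * cosh z) has_real_derivative
          (1 / 2 * ?Q z + ?Q' z * (z / 2) * (z / 2)) * cosh z + sinh z * (z / 2 * ?Q z)) (at z)"
        by (rule DERIV_mult[OF DERIV_mult[OF half dQ]]) (auto intro!: derivative_eq_intros)
      moreover have "((\<lambda>z. sinh z * ?P z) has_real_derivative
          cosh z * ?P z + ?P' z * (z / 2) * sinh z) (at z)"
        by (rule DERIV_mult[OF _ dP]) (auto intro!: derivative_eq_intros)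
      ultimately show ?thesis
        by (rule DERIV_diff[rotated])
    qed
    fix z :: real assume "z > 0"
    have P': "?P' z = ?Q z"
      using lommel_series_raise[of "z\<^sup>2 / 4" 0 \<nu>] \<open>z > 0\<close> by simp
    have Q': "z / 2 * (?Q' z * (z / 2)) = ?P z - (\<nu> + 1) * ?Q z"
      using lommel_series_lower[of "z\<^sup>2 / 4" 0 \<nu>] by (simp add: power2_eq_square algebra_simps)
    \<comment> \<open>Grouped so that the \<open>sinh\<close> part vanishes by \<open>P'\<close>,
      and \<open>Q'\<close> leaves only a multiple of \<open>?Q z\<close> in the \<open>cosh\<close>
      part.\<close>
    have "?F' z = cosh z * (?P z - 1 / 2 * ?Q z - z / 2 * (?Q' z * (z / 2)))
        + sinh z * (z / 2) * (?P' z - ?Q z)"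
      by (simp add: algebra_simps)
    also have "\<dots> = (\<nu> + 1/2) * ?Q z * cosh z"
      unfolding P' Q' by (simp add: algebra_simps)
    also have "\<dots> \<ge> 0"
      using assms \<open>z > 0\<close> by (auto intro!: mult_nonneg_nonneg less_imp_le[OF lommel_series_pos])
    finally show "?F' z \<ge> 0" .
  qed (use assms in auto)
  then show ?thesis by simp
qed

section \<open>Condition numbers in terms of the series\<close>

lemma half_powr_add_even:
  assumes "x > (0::real)"
  shows "(x / 2) powr (e + 2 * real k) = (x / 2) powr e * (x\<^sup>2 / 4) ^ k"
proof -
  have "(x / 2) powr (2 * real k) = (x / 2) ^ (2 * k)"
    using assms powr_realpow[of "x / 2" "2 * k"] by simp
  then show ?thesis
    by (simp add: powr_add power_mult power_divide)
qed

lemma mod_lommel_eq: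
  assumes "x > 0"
  shows "mod_lommel \<mu> \<nu> x = (x / 2) powr (\<mu> + 1) * lommel_series ((\<mu> - \<nu> + 1) / 2) \<nu> (x\<^sup>2 / 4)"
proof -
  have "(x / 2) powr (\<mu> + 2 * real k + 1) * rGamma (real k + (\<mu> - \<nu> + 3) / 2)
          * rGamma (real k + (\<mu> + \<nu> + 3) / 2)
      = (x / 2) powr (\<mu> + 1) * (lommel_coeff ((\<mu> - \<nu> + 1) / 2) \<nu> k * (x\<^sup>2 / 4) ^ k)" for k
  proof -
    have args: "\<mu> + 2 * real k + 1 = \<mu> + 1 + 2 * real k"
      "real k + (\<mu> - \<nu> + 3) / 2 = real k + (\<mu> - \<nu> + 1) / 2 + 1"
      "real k + (\<mu> + \<nu> + 3) / 2 = real k + (\<mu> - \<nu> + 1) / 2 + \<nu> + 1"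
      by (simp_all add: field_simps)
    show ?thesis
      unfolding args half_powr_add_even[OF assms] lommel_coeff_def by (simp only: mult_ac)
  qed
  then show ?thesis
    unfolding mod_lommel_def lommel_series_def by (simp add: suminf_mult summable_lommel)
qed

lemma bessel_I_eq:
  assumes "x > 0"
  shows "bessel_I \<nu> x = (x / 2) powr \<nu> * lommel_series 0 \<nu> (x\<^sup>2 / 4)"
proof -
  have "(x / 2) powr (2 * real k + \<nu>) / fact k * rGamma (real k + \<nu> + 1)
      = (x / 2) powr \<nu> * (lommel_coeff 0 \<nu> k * (x\<^sup>2 / 4) ^ k)" for k
  proof -
    have "rGamma (real k + 1) = inverse (fact k)"
      using Gamma_fact[of k, where 'a = real] by (simp add: rGamma_inverse_Gamma add_ac)
    then show ?thesis
      using half_powr_add_even[OF assms, of \<nu> k]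
      by (simp add: lommel_coeff_def add_ac field_simps)
  qed
  then show ?thesis
    unfolding bessel_I_def lommel_series_def by (simp add: suminf_mult summable_lommel)
qed

text \<open>A condition number is a derivative of log f with respect to log x: the power contributes
  \<open>e\<close>, and the inner square doubles the contribution of \<open>F\<close>.\<close>

lemma condition_number_powr_mult:
  assumes "x > 0"
    and f: "\<And>t. t > 0 \<Longrightarrow> f t = (t / 2) powr e * F (t\<^sup>2 / 4)"
    and F: "(F has_real_derivative F') (at (x\<^sup>2 / 4))" "F (x\<^sup>2 / 4) \<noteq> 0"
  shows "condition_number f x = e + 2 * (x\<^sup>2 / 4 * F') / F (x\<^sup>2 / 4)"
proof -
  let ?g = "\<lambda>t. (t / 2) powr e * F (t\<^sup>2 / 4)"
  let ?D = "e / x * (x / 2) powr e * F (x\<^sup>2 / 4) + F' * (x / 2) * (x / 2) powr e"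
  have dF: "((\<lambda>t. F (t\<^sup>2 / 4)) has_real_derivative F' * (x / 2)) (at x)"
    by (rule DERIV_chain2[where f = F and g = "\<lambda>t. t\<^sup>2 / 4", OF F(1)]) (auto intro!: derivative_eq_intros)
  have "((\<lambda>t. (t / 2) powr e) has_real_derivative e / x * (x / 2) powr e) (at x)"
    using \<open>x > 0\<close> by (auto intro!: derivative_eq_intros simp: powr_diff)
  from DERIV_mult[OF this dF] have "(?g has_real_derivative ?D) (at x)" .
  \<comment> \<open>The product formula for \<open>f\<close> is known only on the open half-line, so
    the derivative is transferred there.\<close>
  then have "(f has_real_derivative ?D) (at x)"
    by (rule has_field_derivative_transform_within_open[of _ _ _ "{0<..}"]) (use assms in auto)
  then have "deriv f x = ?D"
    by (rule DERIV_imp_deriv)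
  then show ?thesis
    using assms f[of x] by (simp add: condition_number_def field_simps power2_eq_square)
qed

text \<open>As \<open>\<mu> + 1 = \<nu> + 2 * \<rho>\<close>, the term with \<open>\<rho>\<close> in
  \<open>lommel_series_raise\<close> turns the leading constant into \<open>\<nu>\<close>, the same
  as for the Bessel function.\<close>

lemma condition_number_mod_lommel:
  assumes "x > 0" "\<nu> \<ge> -1" "\<nu> < \<mu> + 1"
  defines "\<rho> \<equiv> (\<mu> - \<nu> + 1) / 2" and "y \<equiv> x\<^sup>2 / 4"
  shows "condition_number (mod_lommel \<mu> \<nu>) x
           = \<nu> + 2 * (rGamma \<rho> * rGamma (\<rho> + \<nu> + 1) + y * lommel_series \<rho> (\<nu> + 1) y)
               / lommel_series \<rho> \<nu> y"
proof -
  have pos: "lommel_series \<rho> \<nu> y > 0"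
    using assms by (intro lommel_series_pos) (auto simp: \<rho>_def y_def field_simps)
  have "condition_number (mod_lommel \<mu> \<nu>) x
      = \<mu> + 1 + 2 * (y * lommel_series_deriv \<rho> \<nu> y) / lommel_series \<rho> \<nu> y"
    unfolding y_def
    by (rule condition_number_powr_mult)
      (use assms pos in \<open>auto simp: mod_lommel_eq lommel_series_has_derivative\<close>)
  also have "y * lommel_series_deriv \<rho> \<nu> y
      = rGamma \<rho> * rGamma (\<rho> + \<nu> + 1) + y * lommel_series \<rho> (\<nu> + 1) y - \<rho> * lommel_series \<rho> \<nu> y"
    using lommel_series_raise[of y \<rho> \<nu>] by simp
  also have "\<mu> + 1 = \<nu> + 2 * \<rho>"
    by (simp add: \<rho>_def field_simps)
  finally show ?thesis
    using pos by (simp add: field_simps)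
qed

lemma condition_number_bessel_I:
  assumes "x > 0" "\<nu> \<ge> -1"
  defines "y \<equiv> x\<^sup>2 / 4"
  shows "condition_number (bessel_I \<nu>) x
           = \<nu> + 2 * (y * lommel_series 0 (\<nu> + 1) y) / lommel_series 0 \<nu> y"
proof -
  have "lommel_series 0 \<nu> y > 0"
    using assms by (intro lommel_series_pos) auto
  then have "condition_number (bessel_I \<nu>) x
      = \<nu> + 2 * (y * lommel_series_deriv 0 \<nu> y) / lommel_series 0 \<nu> y"
    unfolding y_def
    by (intro condition_number_powr_mult)
      (use assms in \<open>auto simp: bessel_I_eq lommel_series_has_derivative\<close>)
  then show ?thesis
    using lommel_series_raise[of y 0 \<nu>] by simp
qed

text \<open>This form uses the ratio of orders \<open>\<nu> - 1\<close> and \<open>\<nu>\<close>, so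
  that upper bounds on Bessel ratios yield the lower bounds in (ii).\<close>

lemma condition_number_bessel_I':
  assumes "x > 0" "\<nu> \<ge> 0"
  defines "y \<equiv> x\<^sup>2 / 4"
  shows "condition_number (bessel_I \<nu>) x
           = 2 * lommel_series 0 (\<nu> - 1) y / lommel_series 0 \<nu> y - \<nu>"
proof -
  have "lommel_series 0 \<nu> y > 0"
    using assms by (intro lommel_series_pos) auto
  moreover have "lommel_series_deriv 0 \<nu> y = lommel_series 0 (\<nu> + 1) y"
    using lommel_series_raise[of y 0 \<nu>] assms by simp
  then have "y * lommel_series 0 (\<nu> + 1) y = lommel_series 0 (\<nu> - 1) y - \<nu> * lommel_series 0 \<nu> y"
    using lommel_series_lower[of y 0 "\<nu> - 1"] by simp
  ultimately show ?thesis
    using condition_number_bessel_I[of x \<nu>] assms by (simp add: field_simps)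
qed

text \<open>Identifies \<open>lommel_b\<close> with the constant of
  \<open>lommel_series_raise\<close> divided by the series.\<close>

lemma lommel_b_eq:
  assumes "x > 0" "\<nu> \<ge> -1" "\<nu> < \<mu> + 1"
  defines "\<rho> \<equiv> (\<mu> - \<nu> + 1) / 2"
  shows "lommel_b \<mu> \<nu> x = rGamma \<rho> * rGamma (\<rho> + \<nu> + 1) / lommel_series \<rho> \<nu> (x\<^sup>2 / 4)"
proof -
  have "(\<mu> + \<nu> + 3) / 2 = \<rho> + \<nu> + 1"
    by (simp add: \<rho>_def field_simps)
  then show ?thesis
    using assms by (simp add: lommel_b_def mod_lommel_eq rGamma_inverse_Gamma field_simps)
qed

section \<open>Comparison of the two condition numbers\<close>

lemma bessel_less_mod_lommel:
  assumes "x > 0" "\<nu> \<ge> 0" "\<nu> < \<mu> + 1"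
  shows "condition_number (bessel_I \<nu>) x < condition_number (mod_lommel \<mu> \<nu>) x"
proof -
  define \<rho> y where "\<rho> = (\<mu> - \<nu> + 1) / 2" and "y = x\<^sup>2 / 4"
  have \<rho>y: "\<rho> > 0" "y > 0"
    using assms by (auto simp: \<rho>_def y_def)
  then have "lommel_series \<rho> \<nu> y > 0" "lommel_series 0 \<nu> y > 0"
    using assms by (auto intro!: lommel_series_pos)
  then have "y * lommel_series 0 (\<nu> + 1) y / lommel_series 0 \<nu> y
      < (rGamma \<rho> * rGamma (\<rho> + \<nu> + 1) + y * lommel_series \<rho> (\<nu> + 1) y) / lommel_series \<rho> \<nu> y"
    using bessel_cross_less[of \<rho> \<nu> y] assms \<rho>y
    by (simp add: bessel_cross_def divide_less_eq less_divide_eq algebra_simps)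
  then have "2 * (y * lommel_series 0 (\<nu> + 1) y / lommel_series 0 \<nu> y)
      < 2 * ((rGamma \<rho> * rGamma (\<rho> + \<nu> + 1) + y * lommel_series \<rho> (\<nu> + 1) y) / lommel_series \<rho> \<nu> y)"
    by linarith
  moreover have "\<nu> \<ge> -1"
    using assms by simp
  ultimately show ?thesis
    using assms
    by (simp only: condition_number_mod_lommel condition_number_bessel_I
        times_divide_eq_right add_less_cancel_left flip: \<rho>_def y_def)
qed

text \<open>The term \<open>2 * lommel_b \<mu> \<nu> x\<close> is exactly the constant's share of
  the Lommel condition number; what remains is the comparison of Q/P given by
  \<open>bessel_cross_pos\<close>.\<close>

lemma mod_lommel_less_bessel:
  assumes "x > 0" "\<nu> \<ge> -1" "\<nu> < \<mu> + 1"
  shows "condition_number (mod_lommel \<mu> \<nu>) x < condition_number (bessel_I \<nu>) x + 2 * lommel_b \<mu> \<nu> x"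
proof -
  define \<rho> y where "\<rho> = (\<mu> - \<nu> + 1) / 2" and "y = x\<^sup>2 / 4"
  have \<rho>y: "\<rho> > 0" "y > 0"
    using assms by (auto simp: \<rho>_def y_def)
  then have "lommel_series \<rho> \<nu> y > 0" "lommel_series 0 \<nu> y > 0"
    using assms by (auto intro!: lommel_series_pos)
  then have "lommel_series \<rho> (\<nu> + 1) y / lommel_series \<rho> \<nu> y
               < lommel_series 0 (\<nu> + 1) y / lommel_series 0 \<nu> y"
    using bessel_cross_pos[of \<rho> \<nu> y] assms \<rho>y
    by (simp add: bessel_cross_def divide_less_eq less_divide_eq mult_ac)
  then have "y * (lommel_series \<rho> (\<nu> + 1) y / lommel_series \<rho> \<nu> y)
               < y * (lommel_series 0 (\<nu> + 1) y / lommel_series 0 \<nu> y)"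
    using \<rho>y by (intro mult_strict_left_mono)
  moreover have "condition_number (bessel_I \<nu>) x
      = \<nu> + 2 * (y * (lommel_series 0 (\<nu> + 1) y / lommel_series 0 \<nu> y))"
    using condition_number_bessel_I[of x \<nu>] assms by (simp add: y_def)
  moreover have "condition_number (mod_lommel \<mu> \<nu>) x
      = \<nu> + 2 * lommel_b \<mu> \<nu> x + 2 * (y * (lommel_series \<rho> (\<nu> + 1) y / lommel_series \<rho> \<nu> y))"
    using condition_number_mod_lommel[of x \<nu> \<mu>] lommel_b_eq[of x \<nu> \<mu>] assms
    by (simp add: y_def \<rho>_def add_divide_distrib distrib_left)
  ultimately show ?thesis by linarith
qed

section \<open>Explicit bounds for the Bessel condition number\<close>

lemma bessel_condition_sqrt_upper:
  assumes "x > 0" "\<nu> \<ge> -1/2"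
  shows "condition_number (bessel_I \<nu>) x \<le> sqrt ((\<nu> + 1/2)\<^sup>2 + x\<^sup>2) - 1/2"
proof -
  define y where "y = x\<^sup>2 / 4"
  let ?P = "lommel_series 0 \<nu> y" and ?Q = "lommel_series 0 (\<nu> + 1) y"
  have "y > 0" using assms by (simp add: y_def)
  then have P: "?P > 0"
    using assms by (auto intro!: lommel_series_pos)
  define r where "r = ?Q / ?P"
  have "y * ?Q\<^sup>2 + (\<nu> + 1/2) * ?P * ?Q \<le> ?P\<^sup>2"
    using bessel_amos[of \<nu> y] assms \<open>y > 0\<close> by simp
  then have "(y * ?Q\<^sup>2 + (\<nu> + 1/2) * ?P * ?Q) / ?P\<^sup>2 \<le> 1"
    using P by simp
  moreover have "(y * ?Q\<^sup>2 + (\<nu> + 1/2) * ?P * ?Q) / ?P\<^sup>2 = y * r\<^sup>2 + (\<nu> + 1/2) * r"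
    using P by (simp add: r_def field_simps power2_eq_square)
  \<comment> \<open>The factor \<open>4 * y\<close>, equal to the square of \<open>x\<close>,
    prepares completing the square in \<open>2 * (y * r)\<close>.\<close>
  ultimately have "4 * y * (y * r\<^sup>2 + (\<nu> + 1/2) * r) \<le> 4 * y * 1"
    using \<open>y > 0\<close> by (intro mult_left_mono) auto
  then have "(2 * (y * r) + (\<nu> + 1/2))\<^sup>2 \<le> (\<nu> + 1/2)\<^sup>2 + x\<^sup>2"
    by (simp add: y_def power2_eq_square algebra_simps)
  then have "2 * (y * r) + (\<nu> + 1/2) \<le> sqrt ((\<nu> + 1/2)\<^sup>2 + x\<^sup>2)"
    by (rule real_le_rsqrt)
  then show ?thesis
    using condition_number_bessel_I[of x \<nu>] assms by (simp add: r_def flip: y_def)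
qed

lemma bessel_condition_tanh_upper:
  assumes "x > 0" "\<nu> \<ge> -1/2"
  shows "condition_number (bessel_I \<nu>) x \<le> x * tanh x + \<nu>"
proof -
  define y where "y = x\<^sup>2 / 4"
  let ?P = "lommel_series 0 \<nu> y" and ?Q = "lommel_series 0 (\<nu> + 1) y"
  have P: "?P > 0"
    using assms by (auto intro!: lommel_series_pos simp: y_def)
  have "x / 2 * ?Q * cosh x \<le> sinh x * ?P"
    using bessel_tanh[OF assms(2,1)] by (simp add: y_def)
  then have "x / 2 * ?Q / ?P \<le> tanh x"
    using P by (simp add: tanh_def divide_le_eq le_divide_eq mult_ac)
  then have "x * (x / 2 * ?Q / ?P) \<le> x * tanh x"
    using assms by (intro mult_left_mono) auto
  moreover have "x * (x / 2 * ?Q / ?P) = 2 * (y * ?Q) / ?P"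
    by (simp add: y_def power2_eq_square)
  ultimately show ?thesis
    using condition_number_bessel_I[of x \<nu>] assms by (simp flip: y_def)
qed

text \<open>\<open>bessel_amos\<close> at \<open>\<nu> - 1\<close>, read as a quadratic inequality
  for the reciprocal ratio \<open>m\<close>.\<close>

lemma bessel_condition_sqrt_lower:
  assumes "x > 0" "\<nu> \<ge> 1/2"
  shows "sqrt ((\<nu> - 1/2)\<^sup>2 + x\<^sup>2) - 1/2 \<le> condition_number (bessel_I \<nu>) x"
proof -
  define y where "y = x\<^sup>2 / 4"
  let ?P = "lommel_series 0 (\<nu> - 1) y" and ?Q = "lommel_series 0 \<nu> y"
  have "y > 0" using assms by (simp add: y_def)
  then have PQ: "?P > 0" "?Q > 0"
    using assms by (auto intro!: lommel_series_pos)
  define m where "m = ?P / ?Q"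
  have "m > 0" using PQ by (simp add: m_def)
  have "y * ?Q\<^sup>2 + (\<nu> - 1/2) * ?P * ?Q \<le> ?P\<^sup>2"
    using bessel_amos[of "\<nu> - 1" y] assms \<open>y > 0\<close> by simp
  then have "(y * ?Q\<^sup>2 + (\<nu> - 1/2) * ?P * ?Q) / ?Q\<^sup>2 \<le> ?P\<^sup>2 / ?Q\<^sup>2"
    by (intro divide_right_mono) auto
  moreover have "(y * ?Q\<^sup>2 + (\<nu> - 1/2) * ?P * ?Q) / ?Q\<^sup>2 = y + (\<nu> - 1/2) * m"
    using PQ by (simp add: m_def field_simps power2_eq_square)
  ultimately have m: "y + (\<nu> - 1/2) * m \<le> m * m"
    by (simp add: m_def power2_eq_square)
  \<comment> \<open>This excludes the negative branch: \<open>m\<close> exceeds both 0 and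
    \<open>\<nu> - 1/2\<close>, so \<open>2 * m - (\<nu> - 1/2)\<close> is positive and the root can
    be taken.\<close>
  then have "(\<nu> - 1/2) * m < m * m"
    using \<open>y > 0\<close> by linarith
  then have "\<nu> - 1/2 < m"
    using \<open>m > 0\<close> by (simp only: mult_less_cancel_right_pos)
  moreover have "(\<nu> - 1/2)\<^sup>2 + x\<^sup>2 \<le> (2 * m - (\<nu> - 1/2))\<^sup>2"
    using m by (simp add: y_def power2_eq_square algebra_simps)
  ultimately have "sqrt ((\<nu> - 1/2)\<^sup>2 + x\<^sup>2) \<le> 2 * m - (\<nu> - 1/2)"
    using \<open>m > 0\<close> by (intro real_le_lsqrt) auto
  then show ?thesis
    using condition_number_bessel_I'[of x \<nu>] assms by (simp add: m_def flip: y_def)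
qed

text \<open>\<open>bessel_tanh\<close> at \<open>\<nu> - 1\<close>, inverted, which turns
  \<open>tanh\<close> into \<open>coth\<close>.\<close>

lemma bessel_condition_coth_lower:
  assumes "x > 0" "\<nu> \<ge> 1/2"
  shows "x * coth x - \<nu> \<le> condition_number (bessel_I \<nu>) x"
proof -
  define y where "y = x\<^sup>2 / 4"
  let ?P = "lommel_series 0 (\<nu> - 1) y" and ?Q = "lommel_series 0 \<nu> y"
  have Q: "?Q > 0"
    using assms by (auto intro!: lommel_series_pos simp: y_def)
  have "x / 2 * ?Q * cosh x \<le> sinh x * ?P"
    using bessel_tanh[of "\<nu> - 1" x] assms by (simp add: y_def)
  moreover have "sinh x > 0"
    using assms by simp
  ultimately have "x * coth x \<le> 2 * ?P / ?Q"
    using Q by (simp add: coth_def divide_le_eq le_divide_eq mult_ac)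
  then show ?thesis
    using condition_number_bessel_I'[of x \<nu>] assms by (simp flip: y_def)
qed

theorem theorem4p1:
  fixes \<mu> \<nu> x :: real
  assumes "x > 0"
  shows
    "(\<mu> > -1 \<and> 0 \<le> \<nu> \<and> \<nu> < \<mu> + 1 \<longrightarrow>
        condition_number (bessel_I \<nu>) x < condition_number (mod_lommel \<mu> \<nu>) x) \<and>
     (\<mu> > -2 \<and> -1 \<le> \<nu> \<and> \<nu> < \<mu> + 1 \<longrightarrow>
        condition_number (mod_lommel \<mu> \<nu>) x
          < condition_number (bessel_I \<nu>) x + 2 * lommel_b \<mu> \<nu> x) \<and>
     (\<mu> > -1/2 \<and> 1/2 \<le> \<nu> \<and> \<nu> < \<mu> + 1 \<longrightarrow>
        sqrt ((\<nu> - 1/2)\<^sup>2 + x\<^sup>2) - 1/2 < condition_number (mod_lommel \<mu> \<nu>) x \<and>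
        x * coth x - \<nu> < condition_number (mod_lommel \<mu> \<nu>) x) \<and>
     (\<mu> > -3/2 \<and> -1/2 \<le> \<nu> \<and> \<nu> < \<mu> + 1 \<longrightarrow>
        condition_number (mod_lommel \<mu> \<nu>) x
          < sqrt ((\<nu> + 1/2)\<^sup>2 + x\<^sup>2) + 2 * lommel_b \<mu> \<nu> x - 1/2 \<and>
        condition_number (mod_lommel \<mu> \<nu>) x
          < x * tanh x + \<nu> + 2 * lommel_b \<mu> \<nu> x)"
proof (intro conjI impI; elim conjE)
\<comment> \<open>Each bound in (ii) chains a non-strict Bessel bound with an inequality of (i),
  which supplies the strictness.\<close>
qed (use assms bessel_less_mod_lommel[of x \<nu> \<mu>] mod_lommel_less_bessel[of x \<nu> \<mu>]
      bessel_condition_sqrt_lower[of x \<nu>] bessel_condition_coth_lower[of x \<nu>]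
      bessel_condition_sqrt_upper[of x \<nu>] bessel_condition_tanh_upper[of x \<nu>] in linarith)+

end
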